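(* Let $(\mathfrak{g},\langle\,,\rangle)$ be a flat pseudo-Euclidean 2-step nilpotent Lie algebra. Then $(\mathfrak{g},\langle\,,\rangle)$ is obtained (up to isometric isomorphism) by a finite sequence of double extensions starting from an abelian pseudo-Euclidean Lie algebra.
   Context: A pseudo-Euclidean Lie algebra $(\mathfrak{g},\langle\,,\rangle)$ is a finite-dimensional real Lie algebra with a non-degenerate symmetric bilinear form. Its Levi-Civita product $(u,v)\mapsto u.v$ is defined by $2\langle u.v,w\rangle=\langle[u,v],w\rangle+\langle[w,u],v\rangle+\langle[w,v],u\rangle$. Write $\mathrm{L}_u v=u.v$ and $\mathrm{R}_uv=v.u$. It is flat if the Levi-Civita product is left symmetric: $(u.v).w-u.(v.w)=(v.u).w-v.(u.w)$ for all $u,v,w$; equivalently $\mathrm{L}_{[u,v]}=[\mathrm{L}_u,\mathrm{L}_v]$. A 2-step nilpotent Lie algebra is a non-abelian Lie algebra with $[\mathfrak{g},\mathfrak{g}]\subset Z(\mathfrak{g})$, where $Z(\mathfrak{g})$ is the center. Double extension. Let $(B,[\,,]_0,\langle\,,\rangle_0)$ be a flat pseudo-Euclidean Lie algebra with Levi-Civita product written $a.b$, let $\xi,D:B\to B$ be endomorphisms, $b_0\in B$, $\mu\in\mathbb{R}$. The quadruple $(\xi,D,\mu,b_0)$ is admissible if: (1) $\xi([a,b]_0)=\mathrm{L}_a\xi(b)-\mathrm{L}_b\xi(a)$ for all $a,b\in B$; (2) $D-\xi$ is skew-symmetric with respect to $\langle\,,\rangle_0$, $[D,\xi]=\xi^2-\mu\xi-\mathrm{R}_{b_0}$,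 and $a.\xi(b)-\xi(a.b)=D(a).b+a.D(b)-D(a.b)$ for all $a,b\in B$. Given an admissible $(\xi,D,\mu,b_0)$, the double extension of $(B,[\,,]_0,\langle\,,\rangle_0)$ according to $(\xi,D,\mu,b_0)$ is the vector space $\mathbb{R}e\oplus B\oplus\mathbb{R}\bar e$ with the form $\langle\,,\rangle$ extending $\langle\,,\rangle_0$, for which $\mathrm{span}\{e,\bar e\}$ and $B$ are orthogonal, $\langle e,e\rangle=\langle\bar e,\bar e\rangle=0$, $\langle e,\bar e\rangle=1$, and with the bracket $[\bar e,e]=\mu e$, $[\bar e,a]=D(a)-\langle b_0,a\rangle_0e$, $[a,b]=[a,b]_0+\langle(\xi-\xi^* )(a),b\rangle_0e$ for $a,b\in B$, where $\xi^*$ is the adjoint of $\xi$ with respect to $\langle\,,\rangle_0$; this is a flat pseudo-Euclidean Lie algebra. *)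

theory Defs
  imports "HOL-Analysis.Product_Vector"
begin

text \<open>
  Dimensions vary along a sequence of double extensions, so an algebra is carried by a linear
  subspace of an ambient real vector space. The values of bracket and form off the carrier are
  irrelevant.
\<close>

record 'a pe_algebra =
  pe_carrier :: "'a set"
  pe_bracket :: "'a \<Rightarrow> 'a \<Rightarrow> 'a"
  pe_form :: "'a \<Rightarrow> 'a \<Rightarrow> real"

definition linear_on :: "'a::real_vector set \<Rightarrow> 'b::real_vector set \<Rightarrow> ('a \<Rightarrow> 'b) \<Rightarrow> bool" where
  "linear_on V W f \<longleftrightarrow>
     (\<forall>x\<in>V. f x \<in> W) \<and>
     (\<forall>x\<in>V. \<forall>y\<in>V. f (x + y) = f x + f y) \<and>
     (\<forall>c. \<forall>x\<in>V. f (c *\<^sub>R x) = c *\<^sub>R f x)"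

definition bilinear_on :: "'a::real_vector set \<Rightarrow> 'b::real_vector set \<Rightarrow> ('a \<Rightarrow> 'a \<Rightarrow> 'b) \<Rightarrow> bool" where
  "bilinear_on V W f \<longleftrightarrow>
     (\<forall>u\<in>V. linear_on V W (\<lambda>v. f u v)) \<and> (\<forall>v\<in>V. linear_on V W (\<lambda>u. f u v))"

definition lie_algebra :: "'a::real_vector pe_algebra \<Rightarrow> bool" where
  "lie_algebra g \<longleftrightarrow>
     (let V = pe_carrier g; br = pe_bracket g in
       subspace V \<and> (\<exists>S. finite S \<and> V = span S) \<and>
       bilinear_on V V br \<and>
       (\<forall>u\<in>V. br u u = 0) \<and>
       (\<forall>u\<in>V. \<forall>v\<in>V. \<forall>w\<in>V. br u (br v w) + br v (br w u) + br w (br u v) = 0))"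

definition pseudo_euclidean_lie_algebra :: "'a::real_vector pe_algebra \<Rightarrow> bool" where
  "pseudo_euclidean_lie_algebra g \<longleftrightarrow>
     lie_algebra g \<and>
     (let V = pe_carrier g; ip = pe_form g in
       bilinear_on V UNIV ip \<and>
       (\<forall>u\<in>V. \<forall>v\<in>V. ip u v = ip v u) \<and>
       (\<forall>u\<in>V. (\<forall>v\<in>V. ip u v = 0) \<longrightarrow> u = 0))"

text \<open>
  Existence and uniqueness of the vectors described in the next two definitions follow from
  finite dimension and non-degeneracy of the form.
\<close>

definition levi_civita :: "'a::real_vector pe_algebra \<Rightarrow> 'a \<Rightarrow> 'a \<Rightarrow> 'a" where
  "levi_civita g u v =
     (let br = pe_bracket g; ip = pe_form g in
       THE x. x \<in> pe_carrier g \<and>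
         (\<forall>w\<in>pe_carrier g. 2 * ip x w = ip (br u v) w + ip (br w u) v + ip (br w v) u))"

definition pe_adjoint :: "'a::real_vector pe_algebra \<Rightarrow> ('a \<Rightarrow> 'a) \<Rightarrow> 'a \<Rightarrow> 'a" where
  "pe_adjoint g f a =
     (THE x. x \<in> pe_carrier g \<and> (\<forall>b\<in>pe_carrier g. pe_form g x b = pe_form g a (f b)))"

definition flat :: "'a::real_vector pe_algebra \<Rightarrow> bool" where
  "flat g \<longleftrightarrow>
     (let V = pe_carrier g; p = levi_civita g in
       \<forall>u\<in>V. \<forall>v\<in>V. \<forall>w\<in>V. p (p u v) w - p u (p v w) = p (p v u) w - p v (p u w))"

definition abelian :: "'a::real_vector pe_algebra \<Rightarrow> bool" where
  "abelian g \<longleftrightarrow> (\<forall>u\<in>pe_carrier g. \<forall>v\<in>pe_carrier g. pe_bracket g u v = 0)"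

definition lie_center :: "'a::real_vector pe_algebra \<Rightarrow> 'a set" where
  "lie_center g = {z \<in> pe_carrier g. \<forall>u\<in>pe_carrier g. pe_bracket g z u = 0}"

definition derived_algebra :: "'a::real_vector pe_algebra \<Rightarrow> 'a set" where
  "derived_algebra g = span {pe_bracket g u v | u v. u \<in> pe_carrier g \<and> v \<in> pe_carrier g}"

definition two_step_nilpotent :: "'a::real_vector pe_algebra \<Rightarrow> bool" where
  "two_step_nilpotent g \<longleftrightarrow> \<not> abelian g \<and> derived_algebra g \<subseteq> lie_center g"

definition admissible ::
  "'a::real_vector pe_algebra \<Rightarrow> ('a \<Rightarrow> 'a) \<Rightarrow> ('a \<Rightarrow> 'a) \<Rightarrow> real \<Rightarrow> 'a \<Rightarrow> bool" where
  "admissible B \<xi> D \<mu> b0 \<longleftrightarrow>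
     (let V = pe_carrier B; br = pe_bracket B; ip = pe_form B; p = levi_civita B in
       linear_on V V \<xi> \<and> linear_on V V D \<and> b0 \<in> V \<and>
       (\<forall>a\<in>V. \<forall>b\<in>V. \<xi> (br a b) = p a (\<xi> b) - p b (\<xi> a)) \<and>
       (\<forall>a\<in>V. \<forall>b\<in>V. ip (D a - \<xi> a) b = - ip a (D b - \<xi> b)) \<and>
       (\<forall>a\<in>V. D (\<xi> a) - \<xi> (D a) = \<xi> (\<xi> a) - \<mu> *\<^sub>R \<xi> a - p a b0) \<and>
       (\<forall>a\<in>V. \<forall>b\<in>V. p a (\<xi> b) - \<xi> (p a b) = p (D a) b + p a (D b) - D (p a b)))"

text \<open>
  The triple \<open>(s, a, t)\<close> stands for the vector \<open>s e + a + t e'\<close>, where \<open>e'\<close> is the second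
  isotropic generator (written \<open>e\<close> with a bar in the literature). The bracket is the bilinear
  alternating extension of \<open>[e', e] = \<mu> e\<close>, \<open>[e', a] = D a - \<langle>b0, a\<rangle> e\<close>,
  \<open>[a, b] = [a, b]\<^sub>0 + \<langle>(\<xi> - \<xi>\<^sup>*) a, b\<rangle> e\<close> and \<open>[e, a] = 0\<close>.
\<close>

definition double_extension ::
  "'a::real_vector pe_algebra \<Rightarrow> ('a \<Rightarrow> 'a) \<Rightarrow> ('a \<Rightarrow> 'a) \<Rightarrow> real \<Rightarrow> 'a \<Rightarrow>
   (real \<times> 'a \<times> real) pe_algebra" where
  "double_extension B \<xi> D \<mu> b0 =
     \<lparr> pe_carrier = UNIV \<times> pe_carrier B \<times> UNIV,
       pe_bracket = (\<lambda>(s, a, t) (s', a', t').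
         (\<mu> * (t * s' - t' * s) + pe_form B (\<xi> a - pe_adjoint B \<xi> a) a'
            - t * pe_form B b0 a' + t' * pe_form B b0 a,
          pe_bracket B a a' + t *\<^sub>R D a' - t' *\<^sub>R D a,
          0)),
       pe_form = (\<lambda>(s, a, t) (s', a', t'). s * t' + t * s' + pe_form B a a') \<rparr>"

definition isometric_isomorphism ::
  "'a::real_vector pe_algebra \<Rightarrow> 'b::real_vector pe_algebra \<Rightarrow> ('a \<Rightarrow> 'b) \<Rightarrow> bool" where
  "isometric_isomorphism g h f \<longleftrightarrow>
     linear_on (pe_carrier g) (pe_carrier h) f \<and>
     bij_betw f (pe_carrier g) (pe_carrier h) \<and>
     (\<forall>u\<in>pe_carrier g. \<forall>v\<in>pe_carrier g. f (pe_bracket g u v) = pe_bracket h (f u) (f v)) \<and>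
     (\<forall>u\<in>pe_carrier g. \<forall>v\<in>pe_carrier g. pe_form h (f u) (f v) = pe_form g u v)"

text \<open>
  The algebras obtained, up to isometric isomorphism, by finitely many double extensions from an
  abelian one. An isomorphism is allowed after each single step because \<open>double_extension\<close> changes
  the ambient type; a double extension of isomorphic algebras by transported data being isomorphic,
  this amounts to one isomorphism at the end. Keeping all algebras inside one ambient space is no
  restriction either, since the dimension grows along the sequence.
\<close>

inductive iterated_double_extension :: "'a::real_vector pe_algebra \<Rightarrow> bool" where
  base: "pseudo_euclidean_lie_algebra g \<Longrightarrow> abelian g \<Longrightarrow> iterated_double_extension g"
| step: "iterated_double_extension B \<Longrightarrow>
    pseudo_euclidean_lie_algebra B \<Longrightarrow> flat B \<Longrightarrow> admissible B \<xi> D \<mu> b0 \<Longrightarrow>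
    pseudo_euclidean_lie_algebra g \<Longrightarrow>
    isometric_isomorphism g (double_extension B \<xi> D \<mu> b0) f \<Longrightarrow>
    iterated_double_extension g"

end

theory Submission
  imports Defs
begin

text \<open>
  Let \<open>g\<close> be flat and 2-step nilpotent, with Levi-Civita product \<open>u.v\<close>. Everything rests on
  a nonzero central isotropic vector \<open>e\<close> that is orthogonal to the derived algebra. For such a
  vector the Koszul formula gives \<open>u.e = e.u = 0\<close>. As all left multiplications are skew, all
  products are orthogonal to \<open>e\<close>; hence the line of \<open>e\<close> and its orthogonal complement are
  two-sided ideals of the Levi-Civita product. The quotient of the complement by the line
  inherits a flat pseudo-Euclidean structure, \<open>g\<close> is a double extension of it, and it is abelian
  or again 2-step nilpotent. So induction on the dimension applies.

  To find \<open>e\<close> (\<open>exists_central_isotropic\<close>), note that for central \<open>z\<close> the operators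
  \<open>L\<^sub>z\<close> and \<open>R\<^sub>z\<close> coincide and \<open>2 \<langle>u.z, w\<rangle> = \<langle>[w, u], z\<rangle>\<close>, so \<open>z.z' = 0\<close> for central \<open>z\<close>
  and \<open>z'\<close>; flatness then gives \<open>z.(u.z') = u.(z.z') = 0\<close> (\<open>prd_central_central\<close>). If the centre
  is orthogonal to the derived algebra, any nonzero bracket serves as \<open>e\<close>. Otherwise some
  \<open>x = v.z\<close> with \<open>z\<close> central is nonzero. If \<open>x\<close> is central, \<open>e = x\<close> works. If not, some bracket
  \<open>[w, x]\<close> is nonzero, and it is orthogonal to every central \<open>z'\<close>
  because \<open>\<langle>[w, x], z'\<rangle> = 2 \<langle>x.z', w\<rangle> = 2 \<langle>z'.(v.z), w\<rangle> = 0\<close>.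

  For the reduction, choose an isotropic \<open>e'\<close> with \<open>\<langle>e, e'\<rangle> = 1\<close> and realise the quotient as the
  orthogonal complement \<open>B\<close> of \<open>e\<close> and \<open>e'\<close>, with all products taken modulo \<open>e\<close>. The data are
  \<open>\<xi> a = - a.e'\<close>, \<open>D a = [e', a]\<close> modulo \<open>e\<close>, \<open>\<mu> = 0\<close> and \<open>b0 = e'.e'\<close>. Each admissibility
  equation other than the skewness of \<open>D - \<xi>\<close> is one instance of flatness, in which one or two of
  the three arguments are \<open>e'\<close>, read modulo \<open>e\<close>; the skewness is that of left multiplication
  by \<open>e'\<close>.
\<close>

section \<open>Pseudo-Euclidean Lie algebras and the Levi-Civita product\<close>

locale pe_lie =
  fixes g :: "'a::real_vector pe_algebra"
  assumes pe: "pseudo_euclidean_lie_algebra g"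
begin

abbreviation V where "V \<equiv> pe_carrier g"
abbreviation br where "br \<equiv> pe_bracket g"
abbreviation ip where "ip \<equiv> pe_form g"
abbreviation prd where "prd \<equiv> levi_civita g"

lemmas pe_unfold = pe[unfolded pseudo_euclidean_lie_algebra_def lie_algebra_def Let_def
  bilinear_on_def linear_on_def]

lemma sub [simp]: "subspace V" using pe_unfold by simp

lemma mem [simp]:
  "0 \<in> V"
  "x \<in> V \<Longrightarrow> y \<in> V \<Longrightarrow> x + y \<in> V"
  "x \<in> V \<Longrightarrow> y \<in> V \<Longrightarrow> x - y \<in> V"
  "x \<in> V \<Longrightarrow> c *\<^sub>R x \<in> V"
  "x \<in> V \<Longrightarrow> - x \<in> V"
  using sub by (auto intro: subspace_0 subspace_add subspace_diff subspace_scale subspace_neg)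

lemma finite_span: obtains S where "finite S" "V = span S"
  using pe_unfold by auto

lemma br_mem [simp]: "u \<in> V \<Longrightarrow> v \<in> V \<Longrightarrow> br u v \<in> V"
  using pe_unfold by simp

lemma br_lin [simp]:
  "u \<in> V \<Longrightarrow> v \<in> V \<Longrightarrow> w \<in> V \<Longrightarrow> br u (v + w) = br u v + br u w"
  "u \<in> V \<Longrightarrow> v \<in> V \<Longrightarrow> w \<in> V \<Longrightarrow> br (u + v) w = br u w + br v w"
  "u \<in> V \<Longrightarrow> v \<in> V \<Longrightarrow> br u (c *\<^sub>R v) = c *\<^sub>R br u v"
  "u \<in> V \<Longrightarrow> v \<in> V \<Longrightarrow> br (c *\<^sub>R u) v = c *\<^sub>R br u v"
  using pe_unfold by simp_all

lemma br_alt [simp]: "u \<in> V \<Longrightarrow> br u u = 0"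
  using pe_unfold by simp

lemma jacobi:
  "u \<in> V \<Longrightarrow> v \<in> V \<Longrightarrow> w \<in> V \<Longrightarrow> br u (br v w) + br v (br w u) + br w (br u v) = 0"
  using pe_unfold by simp

lemma ip_lin [simp]:
  "u \<in> V \<Longrightarrow> v \<in> V \<Longrightarrow> w \<in> V \<Longrightarrow> ip u (v + w) = ip u v + ip u w"
  "u \<in> V \<Longrightarrow> v \<in> V \<Longrightarrow> w \<in> V \<Longrightarrow> ip (u + v) w = ip u w + ip v w"
  "u \<in> V \<Longrightarrow> v \<in> V \<Longrightarrow> ip u (c *\<^sub>R v) = c * ip u v"
  "u \<in> V \<Longrightarrow> v \<in> V \<Longrightarrow> ip (c *\<^sub>R u) v = c * ip u v"
  using pe_unfold by simp_all

lemma ip_sym: "u \<in> V \<Longrightarrow> v \<in> V \<Longrightarrow> ip u v = ip v u"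
  using pe_unfold by simp

lemma nondegenerate: "u \<in> V \<Longrightarrow> (\<And>v. v \<in> V \<Longrightarrow> ip u v = 0) \<Longrightarrow> u = 0"
  using pe_unfold by simp

lemma br_minus [simp]:
  "u \<in> V \<Longrightarrow> v \<in> V \<Longrightarrow> w \<in> V \<Longrightarrow> br u (v - w) = br u v - br u w"
  "u \<in> V \<Longrightarrow> v \<in> V \<Longrightarrow> w \<in> V \<Longrightarrow> br (u - v) w = br u w - br v w"
  "u \<in> V \<Longrightarrow> v \<in> V \<Longrightarrow> br u (- v) = - br u v"
  "u \<in> V \<Longrightarrow> v \<in> V \<Longrightarrow> br (- u) v = - br u v"
  "u \<in> V \<Longrightarrow> br u 0 = 0"
  "u \<in> V \<Longrightarrow> br 0 u = 0"
  using br_lin(1)[of u v "(-1) *\<^sub>R w"] br_lin(2)[of u "(-1) *\<^sub>R v" w]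
    br_lin(3)[of u v "-1"] br_lin(3)[of u w "-1"] br_lin(4)[of u v "-1"] br_lin(4)[of v w "-1"]
    br_lin(3)[of u u 0] br_lin(4)[of u u 0]
  by (simp_all del: br_lin)

lemma ip_minus [simp]:
  "u \<in> V \<Longrightarrow> v \<in> V \<Longrightarrow> w \<in> V \<Longrightarrow> ip u (v - w) = ip u v - ip u w"
  "u \<in> V \<Longrightarrow> v \<in> V \<Longrightarrow> w \<in> V \<Longrightarrow> ip (u - v) w = ip u w - ip v w"
  "u \<in> V \<Longrightarrow> v \<in> V \<Longrightarrow> ip u (- v) = - ip u v"
  "u \<in> V \<Longrightarrow> v \<in> V \<Longrightarrow> ip (- u) v = - ip u v"
  "u \<in> V \<Longrightarrow> ip u 0 = 0"
  "u \<in> V \<Longrightarrow> ip 0 u = 0"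
  using ip_lin(1)[of u v "(-1) *\<^sub>R w"] ip_lin(2)[of u "(-1) *\<^sub>R v" w]
    ip_lin(3)[of u v "-1"] ip_lin(3)[of u w "-1"] ip_lin(4)[of u v "-1"] ip_lin(4)[of v w "-1"]
    ip_lin(3)[of u u 0] ip_lin(4)[of u u 0]
  by (simp_all del: ip_lin)

lemma br_skew: "u \<in> V \<Longrightarrow> v \<in> V \<Longrightarrow> br u v = - br v u"
  using br_alt[of "u + v"] by (simp del: br_alt add: br_alt[of u] br_alt[of v] eq_neg_iff_add_eq_0 add.commute)

lemma eqI_ip: "u \<in> V \<Longrightarrow> v \<in> V \<Longrightarrow> (\<And>w. w \<in> V \<Longrightarrow> ip u w = ip v w) \<Longrightarrow> u = v"
  using nondegenerate[of "u - v"] by simp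

lemma sum_mem: "(\<And>t. t \<in> S \<Longrightarrow> f t \<in> V) \<Longrightarrow> sum f S \<in> V"
  by (rule subspace_sum[OF sub])

lemma ip_sum_left:
  "finite S \<Longrightarrow> (\<And>t. t \<in> S \<Longrightarrow> f t \<in> V) \<Longrightarrow> v \<in> V \<Longrightarrow> ip (sum f S) v = (\<Sum>t\<in>S. ip (f t) v)"
  by (induction S rule: finite_induct) (auto simp: sum_mem)

text \<open>
  Non-degeneracy in the form needed for the Riesz representation below: on an independent set, a
  vector can be found with prescribed products. To enlarge \<open>S\<close> by \<open>s\<close>, a vector orthogonal
  to \<open>S\<close> but not to \<open>s\<close> is required. If there were none, then subtracting from an arbitrary \<open>v\<close>
  its components along a family dual to \<open>S\<close> would show that \<open>s\<close> pairs with \<open>v\<close> exactly as a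
  fixed combination of \<open>S\<close> does, which forces \<open>s\<close> into the span of \<open>S\<close>.
\<close>

lemma interpolate:
  assumes "finite S" "independent S" "S \<subseteq> V"
  shows "\<exists>x\<in>V. \<forall>s\<in>S. ip x s = \<phi> s"
  using assms
proof (induction S arbitrary: \<phi> rule: finite_induct)
  case empty
  then show ?case using mem(1) by blast
next
  case (insert s S)
  have S: "S \<subseteq> V" "s \<in> V" "independent S" and s: "s \<notin> span S"
    using insert.prems insert.hyps by (auto simp: independent_insert)
  note IH = insert.IH[OF S(3,1)]
  have "\<exists>y\<in>V. (\<forall>t\<in>S. ip y t = 0) \<and> ip y s \<noteq> 0"
  proof (rule ccontr)
    assume no: "\<not> ?thesis"
    have "\<forall>t. \<exists>x\<in>V. \<forall>t'\<in>S. ip x t' = (if t' = t then 1 else 0)"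
      by (intro allI IH)
    then obtain d where d: "\<And>t. d t \<in> V" "\<And>t t'. t' \<in> S \<Longrightarrow> ip (d t) t' = (if t' = t then 1 else 0)"
      by metis
    let ?s = "\<Sum>t\<in>S. ip (d t) s *\<^sub>R t"
    have sV: "?s \<in> V" using S by (intro sum_mem) auto
    have "s = ?s"
    proof (rule eqI_ip)
      fix v assume v: "v \<in> V"
      let ?p = "\<Sum>t\<in>S. ip v t *\<^sub>R d t"
      have pV: "?p \<in> V" using d by (intro sum_mem) auto
      have ipp: "ip ?p w = (\<Sum>t\<in>S. ip v t * ip (d t) w)" if "w \<in> V" for w
        using that insert.hyps(1) d by (subst ip_sum_left) auto
      have "ip (v - ?p) t = 0" if "t \<in> S" for t
        using that S v pV insert.hyps(1) by (auto simp: ipp d(2) subset_iff if_distrib[of "\<lambda>x. _ * x"] cong: if_cong)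
      with no v pV have "ip (v - ?p) s = 0" by (meson mem(3))
      hence "ip v s = (\<Sum>t\<in>S. ip v t * ip (d t) s)" using v pV S ipp by simp
      also have "\<dots> = (\<Sum>t\<in>S. ip (ip (d t) s *\<^sub>R t) v)"
        using v S by (intro sum.cong) (auto simp: ip_sym[of v] subset_iff)
      also have "\<dots> = ip ?s v"
        using insert.hyps(1) v S by (subst ip_sum_left) auto
      finally show "ip s v = ip ?s v" using v S ip_sym by metis
    qed (use S sV in auto)
    moreover have "?s \<in> span S" by (intro span_sum span_scale span_base)
    ultimately show False using s by simp
  qed
  then obtain y where y: "y \<in> V" "\<forall>t\<in>S. ip y t = 0" "ip y s \<noteq> 0" by blast
  from IH obtain x where x: "x \<in> V" "\<forall>t\<in>S. ip x t = \<phi> t" by blast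
  let ?c = "(\<phi> s - ip x s) / ip y s"
  have "ip (x + ?c *\<^sub>R y) t = \<phi> t" if "t \<in> insert s S" for t
    using that S x y by (auto simp: subset_iff)
  then show ?case using x y by (meson mem)
qed

text \<open>
  This is what turns the defining conditions of the Levi-Civita product and of adjoints, which are
  stated through definite descriptions, into usable equations.
\<close>

lemma riesz:
  assumes \<phi>: "linear_on V (UNIV::real set) \<phi>"
  obtains x where "x \<in> V" "\<And>v. v \<in> V \<Longrightarrow> ip x v = \<phi> v"
proof -
  obtain S0 where S0: "finite S0" "V = span S0" by (rule finite_span)
  obtain S where S: "S \<subseteq> S0" "independent S" "S0 \<subseteq> span S"
    using maximal_independent_subset[of S0] by auto
  have fin: "finite S" using S S0 finite_subset by blast
  have V: "V = span S" using S S0 by (metis span_mono span_span subset_antisym)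
  have SV: "S \<subseteq> V" unfolding V by (rule span_superset)
  obtain x where x: "x \<in> V" "\<forall>s\<in>S. ip x s = \<phi> s" using interpolate[OF fin S(2) SV] by blast
  have "v \<in> V \<and> ip x v = \<phi> v" if "v \<in> span S" for v
    using that
  proof (induction rule: span_induct_alt)
    case base
    have "\<phi> (0 *\<^sub>R 0) = 0 *\<^sub>R \<phi> 0" using \<phi> mem(1) unfolding linear_on_def by blast
    then show ?case using x by simp
  next
    case (step c s y)
    then show ?case using x SV \<phi> unfolding linear_on_def by (auto simp: subset_iff)
  qed
  then show ?thesis using that x V by blast
qed

lemma prd_exists:
  assumes "u \<in> V" "v \<in> V"
  shows "\<exists>!x. x \<in> V \<and> (\<forall>w\<in>V. 2 * ip x w = ip (br u v) w + ip (br w u) v + ip (br w v) u)"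
proof -
  have "linear_on V UNIV (\<lambda>w. (ip (br u v) w + ip (br w u) v + ip (br w v) u) / 2)"
    using assms unfolding linear_on_def by (auto simp: field_simps)
  then obtain x where "x \<in> V" "\<And>w. w \<in> V \<Longrightarrow> ip x w = (ip (br u v) w + ip (br w u) v + ip (br w v) u) / 2"
    by (rule riesz) blast
  then have x: "x \<in> V \<and> (\<forall>w\<in>V. 2 * ip x w = ip (br u v) w + ip (br w u) v + ip (br w v) u)"
    by (auto simp: field_simps)
  show ?thesis
    by (rule ex1I[of _ x], rule x, rule eqI_ip) (use x in force)+
qed

lemma prd_props:
  assumes "u \<in> V" "v \<in> V"
  shows prd_mem [simp]: "prd u v \<in> V"
    and koszul: "w \<in> V \<Longrightarrow> ip (prd u v) w = (ip (br u v) w + ip (br w u) v + ip (br w v) u) / 2"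
  using theI'[OF prd_exists[OF assms]] unfolding levi_civita_def Let_def by (blast, fastforce)

text \<open>
  The Koszul formula determines the product; identities between products, as well as the
  Levi-Civita product of a reduced algebra, are obtained by checking it.
\<close>

lemma prd_eqI:
  assumes "u \<in> V" "v \<in> V" "x \<in> V"
    "\<And>w. w \<in> V \<Longrightarrow> 2 * ip x w = ip (br u v) w + ip (br w u) v + ip (br w v) u"
  shows "prd u v = x"
  using assms by (intro eqI_ip) (auto simp: koszul field_simps)

lemma prd_lin [simp]:
  assumes "u \<in> V" "v \<in> V"
  shows "w \<in> V \<Longrightarrow> prd u (v + w) = prd u v + prd u w"
    and "w \<in> V \<Longrightarrow> prd (u + v) w = prd u w + prd v w"
    and "prd u (c *\<^sub>R v) = c *\<^sub>R prd u v"
    and "prd (c *\<^sub>R u) v = c *\<^sub>R prd u v"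
    and "w \<in> V \<Longrightarrow> prd u (v - w) = prd u v - prd u w"
    and "w \<in> V \<Longrightarrow> prd (u - v) w = prd u w - prd v w"
    and "prd u (- v) = - prd u v"
    and "prd (- u) v = - prd u v"
  using assms by (auto intro!: prd_eqI simp: koszul distrib_left right_diff_distrib add_divide_distrib diff_divide_distrib)

lemma prd_torsion: "u \<in> V \<Longrightarrow> v \<in> V \<Longrightarrow> prd u v - prd v u = br u v"
proof (rule eqI_ip)
  fix w assume "u \<in> V" "v \<in> V" "w \<in> V"
  then show "ip (prd u v - prd v u) w = ip (br u v) w"
    using koszul[of u v w] koszul[of v u w] br_skew[of u v] by simp
qed auto

lemma prd_skew: "u \<in> V \<Longrightarrow> v \<in> V \<Longrightarrow> w \<in> V \<Longrightarrow> ip (prd u v) w = - ip v (prd u w)"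
  using koszul[of u v w] koszul[of u w v] br_skew[of u w] br_skew[of v w] br_skew[of u v]
    ip_sym[of v "prd u w"] by simp

lemma adjoint_props:
  assumes f: "linear_on V V f" and a: "a \<in> V"
  shows adjoint_mem: "pe_adjoint g f a \<in> V"
    and adjoint: "b \<in> V \<Longrightarrow> ip (pe_adjoint g f a) b = ip a (f b)"
proof -
  have "linear_on V UNIV (\<lambda>b. ip a (f b))"
    using f a unfolding linear_on_def by auto
  then obtain x where x: "x \<in> V" "\<And>b. b \<in> V \<Longrightarrow> ip x b = ip a (f b)" by (rule riesz) blast
  have "\<exists>!x. x \<in> V \<and> (\<forall>b\<in>V. ip x b = ip a (f b))"
    by (rule ex1I[of _ x]) (use x in \<open>auto intro: eqI_ip\<close>)
  from theI'[OF this] show "pe_adjoint g f a \<in> V"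
    "b \<in> V \<Longrightarrow> ip (pe_adjoint g f a) b = ip a (f b)"
    unfolding pe_adjoint_def by blast+
qed

end


locale flat_pe_lie = pe_lie +
  assumes flat: "flat g"
begin

text \<open>
  Flatness as the vanishing of the curvature, \<open>L\<^bsub>[u, v]\<^esub> = [L\<^sub>u, L\<^sub>v]\<close>. This is the only form in
  which it enters the search for \<open>e\<close> and the admissibility equations.
\<close>

lemma prd_br:
  assumes "u \<in> V" "v \<in> V" "w \<in> V"
  shows "prd (br u v) w = prd u (prd v w) - prd v (prd u w)"
proof -
  have "prd (prd u v) w - prd u (prd v w) = prd (prd v u) w - prd v (prd u w)"
    using flat assms unfolding flat_def Let_def by blast
  then have "prd (prd u v) w = prd (prd v u) w - prd v (prd u w) + prd u (prd v w)"
    by (simp only: diff_eq_eq)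
  moreover have "prd (br u v) w = prd (prd u v) w - prd (prd v u) w"
    using assms by (simp flip: prd_torsion)
  ultimately show ?thesis by simp
qed

end

section \<open>A central isotropic vector orthogonal to the derived algebra\<close>

context pe_lie
begin

text \<open>
  In the Koszul formula the two brackets involving the central vector drop out.
\<close>

lemma prd_central:
  assumes z: "z \<in> V" "\<And>u. u \<in> V \<Longrightarrow> br z u = 0" and u: "u \<in> V"
  shows prd_central_commute: "prd z u = prd u z"
    and prd_central_ip: "w \<in> V \<Longrightarrow> ip (prd u z) w = ip (br w u) z / 2"
proof -
  show "prd z u = prd u z" using prd_torsion[of z u] z u by simp
  show "ip (prd u z) w = ip (br w u) z / 2" if w: "w \<in> V"
    using koszul[of u z w] z u w br_skew[of u z] br_skew[of w z] by simp
qed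

lemma two_stepD:
  assumes "two_step_nilpotent g" "u \<in> V" "v \<in> V" "w \<in> V"
  shows "br (br u v) w = 0"
proof -
  have "br u v \<in> derived_algebra g"
    unfolding derived_algebra_def using assms by (blast intro: span_base)
  then show ?thesis using assms unfolding two_step_nilpotent_def lie_center_def by blast
qed

lemma two_stepI:
  assumes "\<not> abelian g" "\<And>u v w. u \<in> V \<Longrightarrow> v \<in> V \<Longrightarrow> w \<in> V \<Longrightarrow> br (br u v) w = 0"
  shows "two_step_nilpotent g"
proof -
  have "subspace (lie_center g)"
    unfolding lie_center_def by (rule subspaceI) auto
  then have "derived_algebra g \<subseteq> lie_center g"
    unfolding derived_algebra_def by (intro span_minimal) (auto simp: lie_center_def assms(2))
  then show ?thesis using assms(1) unfolding two_step_nilpotent_def by blast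
qed

text \<open>
  Non-degeneracy gives a vector pairing to \<open>1\<close> with \<open>e\<close>; adding a multiple of \<open>e\<close> makes it
  isotropic without changing that pairing.
\<close>

lemma hyperbolic_partner:
  assumes e: "e \<in> V" "e \<noteq> 0" "ip e e = 0"
  obtains e' where "e' \<in> V" "ip e e' = 1" "ip e' e' = 0"
proof -
  obtain y where y: "y \<in> V" "ip e y \<noteq> 0" using nondegenerate[of e] e by blast
  define y' where "y' = (1 / ip e y) *\<^sub>R y"
  have y': "y' \<in> V" "ip e y' = 1" "ip y' e = 1"
    using y e ip_sym[of y e] by (auto simp: y'_def)
  show thesis
    by (rule that[of "y' - (ip y' y' / 2) *\<^sub>R e"]) (use y' e in simp_all)
qed

end

context flat_pe_lie
begin

text \<open>
  Central vectors have product zero by the Koszul formula, and since the curvature term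
  \<open>L\<^bsub>[z, u]\<^esub>\<close> vanishes, \<open>L\<^sub>z\<close> commutes with \<open>L\<^sub>u\<close>; so \<open>z.(u.z') = u.(z.z') = 0\<close>.
\<close>

lemma prd_central_central:
  assumes z: "z \<in> V" "\<And>u. u \<in> V \<Longrightarrow> br z u = 0"
    and z': "z' \<in> V" "\<And>u. u \<in> V \<Longrightarrow> br z' u = 0" and u: "u \<in> V"
  shows "prd z (prd u z') = 0"
proof -
  have "prd z z' = 0"
  proof (rule eqI_ip)
    fix w assume w: "w \<in> V"
    have "br w z = 0" using br_skew[of w z] z w by simp
    then show "ip (prd z z') w = ip 0 w"
      using prd_central_ip[OF z' z(1) w] w z' by simp
  qed (use z z' in auto)
  moreover have "prd (0::'a) z' = 0" "prd u 0 = 0"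
    using prd_lin(4)[of z z' 0] prd_lin(3)[of u z 0] z z' u by simp_all
  ultimately show ?thesis
    using prd_br[of z u z'] z z' u by simp
qed

text \<open>
  The heart of the argument: three cases, in each of which an explicit vector serves. The centre
  contains the derived algebra, so orthogonality to the centre of a vector in the derived algebra
  gives both remaining properties, isotropy and orthogonality to the derived algebra.
\<close>

lemma exists_central_isotropic:
  assumes ts: "two_step_nilpotent g"
  obtains e where "e \<in> V" "e \<noteq> 0" "\<And>u. u \<in> V \<Longrightarrow> br e u = 0" "ip e e = 0"
    "\<And>u v. u \<in> V \<Longrightarrow> v \<in> V \<Longrightarrow> ip e (br u v) = 0"
proof -
  let ?central = "\<lambda>z. z \<in> V \<and> (\<forall>u\<in>V. br z u = 0)"
  have brc: "?central (br u v)" if "u \<in> V" "v \<in> V" for u v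
    using two_stepD[OF ts] that by simp
  show thesis
  proof (cases "\<forall>z u v. ?central z \<longrightarrow> u \<in> V \<longrightarrow> v \<in> V \<longrightarrow> ip z (br u v) = 0")
    case True
    obtain u v where uv: "u \<in> V" "v \<in> V" "br u v \<noteq> 0"
      using ts unfolding two_step_nilpotent_def abelian_def by blast
    show thesis
      by (rule that[of "br u v"]) (use uv brc[of u v] brc True in auto)
  next
    case False
    then obtain z u v where z: "?central z" and uv: "u \<in> V" "v \<in> V" "ip z (br u v) \<noteq> 0" by blast
    let ?x = "prd v z"
    have x: "?x \<in> V" using z uv by simp
    have ipx: "ip ?x w = ip (br w v) z / 2" if "w \<in> V" for w
      using prd_central_ip[of z v w] z uv that by blast
    have "ip ?x u \<noteq> 0" using ipx[OF uv(1)] uv z ip_sym[of z "br u v"] by simp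
    then have "?x \<noteq> 0" using uv by auto
    have cc: "prd z' ?x = 0" if "?central z'" for z'
      using prd_central_central[of z' z v] that z uv by blast
    show thesis
    proof (cases "?central ?x")
      case True
      \<comment> \<open>Here \<open>\<langle>x, x\<rangle> = \<langle>z.v, x\<rangle> = - \<langle>v, z.x\<rangle> = 0\<close>, and \<open>x\<close> is orthogonal to brackets because
        \<open>2 \<langle>x, [a, b]\<rangle> = \<langle>[[a, b], v], z\<rangle>\<close> and \<open>g\<close> is 2-step nilpotent.\<close>
      have "ip (prd z v) ?x = - ip v (prd z ?x)" using prd_skew[of z v ?x] z uv x by blast
      then have "ip ?x ?x = 0"
        using cc[OF z] prd_central_commute[of z v] z uv by simp
      moreover have "ip ?x (br a b) = 0" if "a \<in> V" "b \<in> V" for a b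
        using ipx[of "br a b"] brc[OF that] that uv z by simp
      ultimately show thesis using that[of ?x] True \<open>?x \<noteq> 0\<close> by blast
    next
      case False
      then obtain w where w: "w \<in> V" "br ?x w \<noteq> 0" using x by blast
      let ?e = "br w ?x"
      have e: "?central ?e" "?e \<noteq> 0" using brc x w br_skew[of ?x w] by auto
      have perp: "ip ?e z' = 0" if z': "?central z'" for z'
      proof -
        have "ip (prd ?x z') w = ip (br w ?x) z' / 2"
          using prd_central_ip[of z' ?x w] z' x w by blast
        moreover have "prd ?x z' = 0"
          using cc[OF z'] prd_central_commute[of z' ?x] z' x by simp
        ultimately show ?thesis using w by simp
      qed
      show thesis
        by (rule that[of ?e]) (use e perp brc in auto)
    qed
  qed
qed

end

section \<open>Reduction along a central isotropic vector\<close>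

locale reduction = flat_pe_lie +
  fixes e e' :: 'a
  assumes e [simp]: "e \<in> V" and e' [simp]: "e' \<in> V"
    and ee [simp]: "ip e e = 0" and ee' [simp]: "ip e e' = 1" and e'e' [simp]: "ip e' e' = 0"
    and e_central: "\<And>u. u \<in> V \<Longrightarrow> br e u = 0"
    and e_br [simp]: "\<And>u v. u \<in> V \<Longrightarrow> v \<in> V \<Longrightarrow> ip e (br u v) = 0"
begin

text \<open>
  On the orthogonal complement of \<open>e\<close> this is the projection onto the complement of \<open>e\<close> and
  \<open>e'\<close> along \<open>e\<close>. Brackets and products lie there, so for them it means reduction modulo \<open>e\<close>.
\<close>

definition \<pi> where "\<pi> x = x - ip x e' *\<^sub>R e"

text \<open>
  The quotient of the orthogonal complement of \<open>e\<close> by the line of \<open>e\<close>, realised inside \<open>g\<close> by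
  the representatives orthogonal to \<open>e'\<close>; the ambient type thus stays the same along the
  induction.
\<close>

definition B where
  "B = \<lparr> pe_carrier = {x \<in> V. ip x e = 0 \<and> ip x e' = 0},
         pe_bracket = (\<lambda>a b. \<pi> (br a b)),
         pe_form = ip \<rparr>"

abbreviation \<xi> where "\<xi> \<equiv> \<lambda>a. - prd a e'"
abbreviation D where "D \<equiv> \<lambda>a. \<pi> (br e' a)"
abbreviation b0 where "b0 \<equiv> prd e' e'"

lemma B_sel [simp]: "pe_bracket B a b = \<pi> (br a b)" "pe_form B = ip"
  by (simp_all add: B_def)

lemma B_carrier: "a \<in> pe_carrier B \<longleftrightarrow> a \<in> V \<and> ip a e = 0 \<and> ip a e' = 0"
  by (simp add: B_def)

lemma B_memD [simp]:
  assumes "a \<in> pe_carrier B"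
  shows "a \<in> V" "ip a e = 0" "ip a e' = 0" "ip e a = 0" "ip e' a = 0"
  using assms ip_sym[of e a] ip_sym[of e' a] by (auto simp: B_carrier)

lemma e'e [simp]: "ip e' e = 1" using ip_sym[of e' e] by simp

lemma br_e [simp]: "u \<in> V \<Longrightarrow> br e u = 0" "u \<in> V \<Longrightarrow> br u e = 0"
  using e_central br_skew[of u e] by auto

lemma br_ip_e [simp]: "u \<in> V \<Longrightarrow> v \<in> V \<Longrightarrow> ip (br u v) e = 0"
  using ip_sym[of "br u v" e] by simp

lemma prd_e [simp]:
  assumes u: "u \<in> V" shows "prd u e = 0" "prd e u = 0"
proof -
  show *: "prd u e = 0" by (rule prd_eqI) (use u in auto)
  show "prd e u = 0" using prd_torsion[of e u] u * by simp
qed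

lemma prd_ip_e [simp]: "u \<in> V \<Longrightarrow> v \<in> V \<Longrightarrow> ip (prd u v) e = 0"
  using prd_skew[of u v e] by simp

lemma prd_e'_ip_e' [simp]: "u \<in> V \<Longrightarrow> ip (prd u e') e' = 0"
  using prd_skew[of u e' e'] ip_sym[of e' "prd u e'"] e' prd_mem by fastforce

lemma \<pi>_mem [simp]: "x \<in> V \<Longrightarrow> \<pi> x \<in> V"
  by (simp add: \<pi>_def)

lemma \<pi>_B [simp]: "x \<in> V \<Longrightarrow> ip x e = 0 \<Longrightarrow> \<pi> x \<in> pe_carrier B"
  by (simp add: \<pi>_def B_carrier del: B_memD)

lemma \<pi>_id: "x \<in> V \<Longrightarrow> ip x e' = 0 \<Longrightarrow> \<pi> x = x"
  by (simp add: \<pi>_def)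

lemma \<pi>_lin:
  "x \<in> V \<Longrightarrow> y \<in> V \<Longrightarrow> \<pi> (x + y) = \<pi> x + \<pi> y"
  "x \<in> V \<Longrightarrow> y \<in> V \<Longrightarrow> \<pi> (x - y) = \<pi> x - \<pi> y"
  "x \<in> V \<Longrightarrow> \<pi> (c *\<^sub>R x) = c *\<^sub>R \<pi> x"
  "x \<in> V \<Longrightarrow> \<pi> (- x) = - \<pi> x"
  by (simp_all add: \<pi>_def algebra_simps)

text \<open>
  Since \<open>e\<close> annihilates \<open>g\<close> from both sides, under the bracket as well as under the product,
  reducing an argument modulo \<open>e\<close> changes nothing. Identities of \<open>g\<close> therefore pass to \<open>B\<close> by
  applying \<open>\<pi>\<close> once, on the outside.
\<close>

lemma \<pi>_absorb [simp]:
  assumes "x \<in> V" "y \<in> V"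
  shows "br (\<pi> x) y = br x y" "br x (\<pi> y) = br x y"
    "prd (\<pi> x) y = prd x y" "prd x (\<pi> y) = prd x y"
  using assms by (simp_all add: \<pi>_def)

lemma \<pi>_ip [simp]:
  assumes "x \<in> V" "a \<in> pe_carrier B"
  shows "ip (\<pi> x) a = ip x a" "ip a (\<pi> x) = ip a x"
  using assms by (simp_all add: \<pi>_def)

text \<open>
  As \<open>L\<^sub>u\<close> is skew, \<open>u.e'\<close> is orthogonal to \<open>e'\<close>; so \<open>\<xi>\<close> and \<open>b0\<close> take values in \<open>B\<close> without
  any projection.
\<close>

lemma \<xi>_B [simp]: "u \<in> V \<Longrightarrow> prd u e' \<in> pe_carrier B"
  by (simp add: B_carrier del: B_memD)

lemma B_subspace: "subspace (pe_carrier B)"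
  unfolding subspace_def by (auto simp: B_carrier simp del: B_memD)

lemma decompose:
  assumes "x \<in> V" shows "x - ip x e' *\<^sub>R e - ip x e *\<^sub>R e' \<in> pe_carrier B"
  using assms by (simp add: B_carrier del: B_memD)

lemma B_finite: "\<exists>S. finite S \<and> pe_carrier B = span S"
proof -
  obtain S where S: "finite S" "V = span S" by (rule finite_span)
  obtain T where T: "T \<subseteq> pe_carrier B" "independent T" "pe_carrier B \<subseteq> span T"
    using maximal_independent_subset[of "pe_carrier B"] by auto
  have "T \<subseteq> span S" using T(1) S(2) B_carrier by blast
  then have "finite T" using independent_span_bound[OF S(1) T(2)] by simp
  moreover have "span T \<subseteq> pe_carrier B" using T B_subspace by (intro span_minimal)
  ultimately show ?thesis using T by blast
qed

lemma B_jacobi: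
  assumes "u \<in> V" "v \<in> V" "w \<in> V"
  shows "\<pi> (br u (br v w)) + \<pi> (br v (br w u)) + \<pi> (br w (br u v)) = 0"
proof -
  have "\<pi> (br u (br v w)) + \<pi> (br v (br w u)) + \<pi> (br w (br u v))
      = \<pi> (br u (br v w) + br v (br w u) + br w (br u v))"
    using assms by (simp add: \<pi>_lin)
  also have "\<dots> = 0" using assms by (simp add: jacobi \<pi>_def)
  finally show ?thesis .
qed

lemma B_nondegenerate:
  assumes u: "u \<in> pe_carrier B" and perp: "\<And>v. v \<in> pe_carrier B \<Longrightarrow> ip u v = 0"
  shows "u = 0"
proof (rule nondegenerate)
  fix v assume v: "v \<in> V"
  have "ip u (v - ip v e' *\<^sub>R e - ip v e *\<^sub>R e') = 0" by (rule perp[OF decompose[OF v]])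
  then show "ip u v = 0" using u v by simp
qed (use u in auto)

lemma B_pe: "pseudo_euclidean_lie_algebra B"
  unfolding pseudo_euclidean_lie_algebra_def lie_algebra_def Let_def bilinear_on_def linear_on_def
proof (intro conjI)
  show "subspace (pe_carrier B)" "\<exists>S. finite S \<and> pe_carrier B = span S"
    by (fact B_subspace, fact B_finite)
  show "\<forall>u\<in>pe_carrier B. \<forall>v\<in>pe_carrier B. \<forall>w\<in>pe_carrier B.
     pe_bracket B u (pe_bracket B v w) + pe_bracket B v (pe_bracket B w u) +
     pe_bracket B w (pe_bracket B u v) = 0"
    by (simp add: B_jacobi)
  show "\<forall>u\<in>pe_carrier B. (\<forall>v\<in>pe_carrier B. pe_form B u v = 0) \<longrightarrow> u = 0"
    using B_nondegenerate by auto
  show "\<forall>u\<in>pe_carrier B. \<forall>v\<in>pe_carrier B. pe_form B u v = pe_form B v u"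
    by (auto intro: ip_sym)
qed (simp_all add: \<pi>_lin, simp add: \<pi>_def)

sublocale B: pe_lie B by unfold_locales (fact B_pe)

lemma B_prd:
  assumes "a \<in> pe_carrier B" "b \<in> pe_carrier B"
  shows "levi_civita B a b = \<pi> (prd a b)"
  using assms by (intro B.prd_eqI) (simp_all add: koszul)

lemma B_flat: "flat B"
  unfolding flat_def Let_def
proof (intro ballI)
  fix u v w assume uvw: "u \<in> pe_carrier B" "v \<in> pe_carrier B" "w \<in> pe_carrier B"
  have "\<pi> (prd (prd u v) w - prd u (prd v w)) = \<pi> (prd (prd v u) w - prd v (prd u w))"
    using flat uvw unfolding flat_def Let_def by (metis B_memD(1))
  then show "levi_civita B (levi_civita B u v) w - levi_civita B u (levi_civita B v w) =
             levi_civita B (levi_civita B v u) w - levi_civita B v (levi_civita B u w)"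
    using uvw by (simp add: B_prd \<pi>_lin)
qed

lemma B_two_step:
  assumes "two_step_nilpotent g" "\<not> abelian B"
  shows "two_step_nilpotent B"
  using assms(2) by (rule B.two_stepI) (auto simp: two_stepD[OF assms(1)] \<pi>_def)

lemma \<xi>_linear: "linear_on (pe_carrier B) (pe_carrier B) \<xi>"
  unfolding linear_on_def using B.mem(5) by auto

lemma D_linear: "linear_on (pe_carrier B) (pe_carrier B) D"
  unfolding linear_on_def by (auto simp: \<pi>_lin)

lemma \<pi>_prd_e' [simp]: "u \<in> V \<Longrightarrow> \<pi> (prd u e') = prd u e'"
  by (simp add: \<pi>_id)

text \<open>
  Modulo \<open>e\<close>, the formula for \<open>\<xi>\<close> on a bracket is flatness in the form
  \<open>[a, b].e' = a.(b.e') - b.(a.e')\<close>, the one for the commutator of \<open>D\<close> and \<open>\<xi>\<close> is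
  \<open>[e', a].e' = e'.(a.e') - a.(e'.e')\<close>, and the one comparing \<open>\<xi>\<close> and \<open>D\<close> on a product is
  \<open>[e', a].b = e'.(a.b) - a.(e'.b)\<close>. Finally \<open>(D - \<xi>) a\<close> is \<open>e'.a\<close>, and \<open>L\<close> is skew.
\<close>

lemma admissible_B: "admissible B \<xi> D 0 b0"
  unfolding admissible_def Let_def
proof (intro conjI ballI)
  fix a b assume ab [simp]: "a \<in> pe_carrier B" "b \<in> pe_carrier B"
  have "\<pi> (prd (br a b) e') = \<pi> (prd a (prd b e') - prd b (prd a e'))"
    using prd_br[of a b e'] by simp
  then show "\<xi> (pe_bracket B a b) = levi_civita B a (\<xi> b) - levi_civita B b (\<xi> a)"
    by (simp add: B_prd B.mem(5) \<pi>_lin)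
  have "D a - \<xi> a = \<pi> (prd e' a)" if "a \<in> pe_carrier B" for a
    using prd_torsion[of e' a] that by (simp add: \<pi>_lin flip: prd_torsion)
  then show "pe_form B (D a - \<xi> a) b = - pe_form B a (D b - \<xi> b)"
    using prd_skew[of e' a b] by simp
  have "\<pi> (prd a (prd b e') - prd (prd a b) e') =
     \<pi> (br e' (prd a b) - prd (br e' a) b - prd a (br e' b))"
    using prd_br[of e' a b] by (simp flip: prd_torsion)
  then show "levi_civita B a (\<xi> b) - \<xi> (levi_civita B a b) =
    levi_civita B (D a) b + levi_civita B a (D b) - D (levi_civita B a b)"
    by (simp add: B_prd B.mem(5) \<pi>_lin algebra_simps)
next
  fix a assume a [simp]: "a \<in> pe_carrier B"
  have "\<pi> (prd (br e' a) e' - br e' (prd a e')) = \<pi> (prd (prd a e') e' - prd a b0)"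
    using prd_br[of e' a e'] prd_torsion[of e' "prd a e'"] by (simp flip: prd_torsion)
  then show "D (\<xi> a) - \<xi> (D a) = \<xi> (\<xi> a) - 0 *\<^sub>R \<xi> a - levi_civita B a b0"
    by (simp add: B_prd \<pi>_lin)
qed (rule \<xi>_linear, rule D_linear, simp_all)

text \<open>
  The component along \<open>e\<close> of the bracket of two elements of \<open>B\<close>: by skewness,
  \<open>\<langle>\<xi> a, b\<rangle> = \<langle>a.b, e'\<rangle>\<close> and \<open>\<langle>a, \<xi> b\<rangle> = \<langle>b.a, e'\<rangle>\<close>, and the difference is \<open>\<langle>[a, b], e'\<rangle>\<close>.
\<close>

lemma ip_br_e':
  assumes "a \<in> pe_carrier B" "b \<in> pe_carrier B"
  shows "ip (\<xi> a - pe_adjoint B \<xi> a) b = ip (br a b) e'"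
proof -
  have "ip (pe_adjoint B \<xi> a) b = ip a (\<xi> b)" "pe_adjoint B \<xi> a \<in> pe_carrier B"
    using B.adjoint[OF \<xi>_linear assms] B.adjoint_mem[OF \<xi>_linear assms(1)] by simp_all
  moreover have "ip a (prd b e') = - ip (prd b a) e'" "ip (prd a e') b = - ip (prd a b) e'"
    using prd_skew[of b a e'] prd_skew[of a b e'] ip_sym[of b "prd a e'"] assms by simp_all
  ultimately show ?thesis using assms by (simp flip: prd_torsion)
qed

lemma ip_b0:
  assumes "a \<in> pe_carrier B" shows "ip b0 a = - ip (br e' a) e'"
  using assms koszul[of e' e' a] br_skew[of a e'] by simp

definition coords where
  "coords x = (ip x e', x - ip x e' *\<^sub>R e - ip x e *\<^sub>R e', ip x e)"

lemma coords_isometric_isomorphism: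
  "isometric_isomorphism g (double_extension B \<xi> D 0 b0) coords"
  unfolding isometric_isomorphism_def
proof (intro conjI ballI)
  have "coords x \<in> pe_carrier (double_extension B \<xi> D 0 b0)" if "x \<in> V" for x
    using that by (simp add: coords_def double_extension_def decompose)
  then show "linear_on V (pe_carrier (double_extension B \<xi> D 0 b0)) coords"
    unfolding linear_on_def by (simp add: coords_def algebra_simps)
  show "bij_betw coords V (pe_carrier (double_extension B \<xi> D 0 b0))"
    by (rule bij_betw_byWitness[where f' = "\<lambda>(s, a, t). s *\<^sub>R e + a + t *\<^sub>R e'"])
       (auto simp: coords_def double_extension_def decompose)
next
  fix u v assume uv [simp]: "u \<in> V" "v \<in> V"
  define s a t where "s = ip u e'" "a = u - ip u e' *\<^sub>R e - ip u e *\<^sub>R e'" "t = ip u e"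
  define s' a' t' where "s' = ip v e'" "a' = v - ip v e' *\<^sub>R e - ip v e *\<^sub>R e'" "t' = ip v e"
  have B [simp]: "a \<in> pe_carrier B" "a' \<in> pe_carrier B"
    unfolding s_a_t_def s'_a'_t'_def by (simp_all only: decompose uv)
  have u: "u = s *\<^sub>R e + a + t *\<^sub>R e'" and v: "v = s' *\<^sub>R e + a' + t' *\<^sub>R e'"
    unfolding s_a_t_def s'_a'_t'_def by simp_all
  have cu: "coords u = (s, a, t)" "coords v = (s', a', t')"
    unfolding coords_def s_a_t_def s'_a'_t'_def by simp_all
  show "pe_form (double_extension B \<xi> D 0 b0) (coords u) (coords v) = ip u v"
    unfolding cu by (simp add: u v double_extension_def algebra_simps)
  have b: "br u v = br a a' + t *\<^sub>R br e' a' - t' *\<^sub>R br e' a"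
    using br_skew[of a e'] by (simp add: u v)
  show "coords (br u v) = pe_bracket (double_extension B \<xi> D 0 b0) (coords u) (coords v)"
    unfolding cu b
    by (simp add: coords_def double_extension_def ip_br_e' ip_b0 \<pi>_def algebra_simps)
qed

lemma independent_insert_e':
  assumes "independent T" "T \<subseteq> pe_carrier B"
  shows "independent (insert e' T)" "e' \<notin> T"
proof -
  have "span T \<subseteq> pe_carrier B" using assms B_subspace by (intro span_minimal)
  moreover have "e' \<notin> pe_carrier B" by (simp add: B_carrier del: B_memD)
  ultimately have "e' \<notin> span T" by blast
  then show "independent (insert e' T)" "e' \<notin> T"
    using assms by (auto simp: independent_insert span_base)
qed

end

section \<open>Induction on the dimension\<close>

text \<open>
  The dimension is controlled through the sizes of independent subsets of the carrier: since \<open>e'\<close>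
  lies outside \<open>B\<close>, it extends every independent subset of \<open>B\<close> to a larger one of \<open>g\<close>, so a
  bound \<open>Suc n\<close> for \<open>g\<close> becomes a bound \<open>n\<close> for \<open>B\<close>.
\<close>

lemma iterated_by_dimension:
  fixes g :: "'a::real_vector pe_algebra"
  assumes "pseudo_euclidean_lie_algebra g" "flat g" "two_step_nilpotent g"
    and "\<And>T. independent T \<Longrightarrow> T \<subseteq> pe_carrier g \<Longrightarrow> card T \<le> n"
  shows "iterated_double_extension g"
  using assms
proof (induction n arbitrary: g)
  case (0 g)
  interpret pe_lie g by unfold_locales fact
  obtain u v where uv: "u \<in> V" "v \<in> V" "br u v \<noteq> 0"
    using 0(3) unfolding two_step_nilpotent_def abelian_def by blast
  have "card {br u v} \<le> 0" by (rule 0(4)) (use uv in auto)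
  then show ?case by simp
next
  case (Suc n g)
  interpret flat_pe_lie g by unfold_locales fact+
  obtain e where e: "e \<in> V" "e \<noteq> 0" "\<And>u. u \<in> V \<Longrightarrow> br e u = 0" "ip e e = 0"
    "\<And>u v. u \<in> V \<Longrightarrow> v \<in> V \<Longrightarrow> ip e (br u v) = 0"
    using exists_central_isotropic[OF Suc.prems(3)] by blast
  obtain e' where e': "e' \<in> V" "ip e e' = 1" "ip e' e' = 0"
    using hyperbolic_partner[OF e(1,2,4)] by blast
  interpret reduction g e e' by unfold_locales (use e e' in auto)
  have "iterated_double_extension B"
  proof (cases "abelian B")
    case True
    then show ?thesis by (rule base[OF B_pe])
  next
    case False
    have "card T \<le> n" if T: "independent T" "T \<subseteq> pe_carrier B" for T
    proof -
      obtain S where S: "finite S" "pe_carrier B = span S" using B_finite by blast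
      have "finite T" using independent_span_bound[OF S(1) T(1)] T(2) S by simp
      moreover have "card (insert e' T) \<le> Suc n"
        by (rule Suc.prems(4)) (use T independent_insert_e'[OF T] in auto)
      ultimately show ?thesis using independent_insert_e'[OF T] by simp
    qed
    then show ?thesis
      by (intro Suc.IH B_pe B_flat B_two_step Suc.prems(3) False)
  qed
  then show ?case
    by (rule step[OF _ B_pe B_flat admissible_B Suc.prems(1) coords_isometric_isomorphism])
qed

theorem proposition5p2:
  fixes g :: "'a::real_vector pe_algebra"
  assumes "pseudo_euclidean_lie_algebra g"
    and "flat g"
    and "two_step_nilpotent g"
  shows "iterated_double_extension g"
proof -
  interpret pe_lie g by unfold_locales fact
  obtain S where S: "finite S" "V = span S" by (rule finite_span)
  show ?thesis
    by (rule iterated_by_dimension[OF assms, of "card S"])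
       (use independent_span_bound[OF S(1)] S(2) in auto)
qed

end
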